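(* Let $\Gamma\subset\mathbb{R}^3$ be a compact connected one-dimensional semialgebraic set. The total curvature $K(\Gamma)$, computed using a vertex set $V\subset\Gamma$ making $\Gamma$ a semialgebraic graph, is independent of the choice of the vertex set $V$.
   Context: A semialgebraic graph is a compact connected one-dimensional semialgebraic set $\Gamma\subset\mathbb{R}^3$ together with a finite subset $V\subset\Gamma$ (the vertices) such that $\Gamma\setminus V$ is a finite disjoint union of real analytic, bounded semialgebraic arcs without self-intersections, each connecting two different points of $V$ (the open edges). Multiple edges between two vertices are allowed. For $p\in\Gamma$, $\mathbf{N}_p\subset S^2$ is the finite set of all limits $\lim_k \frac{q_k-p}{|q_k-p|}$ with $q_k\in\Gamma\setminus\{p\}$, $q_k\to p$. For $u\in S^2$ let $h_u(x)=(u,x)$ (Euclidean inner product). A vector $u\in S^2$ is $\Gamma$-nondegenerate (with respect to $V$) if the restriction of $h_u$ to each open edge has only nondegenerate critical points and $(u,\tau)\ne0$ for all $v\in V$, $\tau\in\mathbf{N}_v$; almost every $u\in S^2$ is nondegenerate. For nondegenerate $u$ and $p\in\Gamma$, $d^-_p(u)$ is the number of $q\in\Gamma$ with $|p-q|=\varepsilon$ and $h_u(q)<h_u(p)$, for all sufficiently small $\varepsilon>0$. A stratified critical point of $h_u$ is a vertex or a critical point of the restriction of $h_u$ to an open edge; $\mathrm{Cr}(u)$ is the finite set of these. For $p\in\mathrm{Cr}(u)$ put $w(p,u)=1$ if $p$ is a local minimum of $h_u|_\Gamma$ and $w(p,u)=d^-_p(u)-1$ otherwise; let $w_\Gamma(u)=\sum_{p\in\mathrm{Cr}(u)}w(p,u)$.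 The total curvature is $K(\Gamma)=\frac1{4\pi}\int_{S^2}w_\Gamma(u)\,|d\sigma(u)|$, with $|d\sigma|$ the Euclidean area density on $S^2$. *)

theory Defs
  imports "HOL-Analysis.Analysis"
begin

section \<open>Semialgebraic sets\<close>

inductive semialgebraic :: "'a::euclidean_space set \<Rightarrow> bool" where
  zero: "real_polynomial_function p \<Longrightarrow> semialgebraic {x. p x = 0}"
| pos: "real_polynomial_function p \<Longrightarrow> semialgebraic {x. p x > 0}"
| Un: "semialgebraic A \<Longrightarrow> semialgebraic B \<Longrightarrow> semialgebraic (A \<union> B)"
| Int: "semialgebraic A \<Longrightarrow> semialgebraic B \<Longrightarrow> semialgebraic (A \<inter> B)"
| Compl: "semialgebraic A \<Longrightarrow> semialgebraic (- A)"

text \<open>On semialgebraic sets the semialgebraic dimension is the topological dimension; the latter is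
  taken from the library (small inductive dimension).\<close>

definition one_dimensional :: "'a::euclidean_space set \<Rightarrow> bool" where
  "one_dimensional S \<longleftrightarrow> top_of_set S dim_le 1 \<and> \<not> top_of_set S dim_le 0"

definition semialgebraic_curve :: "(real^3) set \<Rightarrow> bool" where
  "semialgebraic_curve \<Gamma> \<longleftrightarrow>
     compact \<Gamma> \<and> connected \<Gamma> \<and> semialgebraic \<Gamma> \<and> one_dimensional \<Gamma>"


section \<open>Semialgebraic graphs\<close>

definition real_analytic_at :: "(real \<Rightarrow> 'a::real_normed_vector) \<Rightarrow> real \<Rightarrow> bool" where
  "real_analytic_at f t \<longleftrightarrow>
     (\<exists>r>0. \<exists>a. \<forall>s. \<bar>s - t\<bar> < r \<longrightarrow> (\<lambda>n. (s - t) ^ n *\<^sub>R a n) sums f s)"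

text \<open>An open arc is an embedded analytic submanifold, described by parametrisations that are
  injective and continuous on the closed unit interval and analytic and regular on the open one.
  Injectivity includes the two end points, so these are different.\<close>

definition arc_param :: "(real \<Rightarrow> real^3) \<Rightarrow> (real^3) set \<Rightarrow> bool" where
  "arc_param \<gamma> E \<longleftrightarrow>
     arc \<gamma> \<and> \<gamma> ` {0<..<1} = E \<and>
     (\<forall>t\<in>{0<..<1}. real_analytic_at \<gamma> t \<and> vector_derivative \<gamma> (at t) \<noteq> 0)"

definition analytic_arc_between :: "(real^3) set \<Rightarrow> real^3 \<Rightarrow> real^3 \<Rightarrow> bool" where
  "analytic_arc_between E v w \<longleftrightarrow>
     bounded E \<and> semialgebraic E \<and>
     (\<exists>\<gamma>. arc_param \<gamma> E \<and> pathstart \<gamma> = v \<and> pathfinish \<gamma> = w)"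

definition edge_decomposition ::
    "(real^3) set \<Rightarrow> (real^3) set \<Rightarrow> (real^3) set set \<Rightarrow> bool" where
  "edge_decomposition \<Gamma> V \<E> \<longleftrightarrow>
     finite \<E> \<and> disjoint \<E> \<and> \<Union>\<E> = \<Gamma> - V \<and>
     (\<forall>E\<in>\<E>. \<exists>v\<in>V. \<exists>w\<in>V. v \<noteq> w \<and> analytic_arc_between E v w)"

definition semialgebraic_graph :: "(real^3) set \<Rightarrow> (real^3) set \<Rightarrow> bool" where
  "semialgebraic_graph \<Gamma> V \<longleftrightarrow>
     semialgebraic_curve \<Gamma> \<and> finite V \<and> V \<subseteq> \<Gamma> \<and> (\<exists>\<E>. edge_decomposition \<Gamma> V \<E>)"

definition open_edges :: "(real^3) set \<Rightarrow> (real^3) set \<Rightarrow> (real^3) set set" where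
  "open_edges \<Gamma> V = components (\<Gamma> - V)"

text \<open>The decomposition into open edges is determined by the vertex set.\<close>

lemma edge_decomposition_unique:
  assumes dec: "edge_decomposition \<Gamma> V \<E>"
  shows "\<E> = open_edges \<Gamma> V"
proof -
  let ?X = "\<Gamma> - V"
  have un: "\<Union>\<E> = ?X" and fin: "finite \<E>" and dis: "disjoint \<E>"
    using dec by (auto simp: edge_decomposition_def)
  have props: "E \<noteq> {} \<and> connected E \<and> E \<subseteq> ?X \<and> closedin (top_of_set ?X) E" if E: "E \<in> \<E>" for E
  proof -
    obtain \<gamma> where \<gamma>: "arc_param \<gamma> E" and ends: "pathstart \<gamma> \<in> V" "pathfinish \<gamma> \<in> V"
      using dec E unfolding edge_decomposition_def analytic_arc_between_def by metis
    have arc: "arc \<gamma>" and img: "\<gamma> ` {0<..<1} = E"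
      using \<gamma> by (auto simp: arc_param_def)
    have cont: "continuous_on {0..1} \<gamma>"
      using arc by (simp add: arc_def path_def)
    have sub: "E \<subseteq> ?X" using un E by blast
    have "connected E"
      using img connected_continuous_image[of "{0<..<1}" \<gamma>] continuous_on_subset[OF cont]
      by (metis connected_Ioo greaterThanLessThan_subseteq_atLeastAtMost_iff order_refl)
    moreover have "E = ?X \<inter> \<gamma> ` {0..1}"
    proof
      show "E \<subseteq> ?X \<inter> \<gamma> ` {0..1}" using sub img by fastforce
      show "?X \<inter> \<gamma> ` {0..1} \<subseteq> E"
      proof
        fix x assume x: "x \<in> ?X \<inter> \<gamma> ` {0..1}"
        then obtain t where t: "x = \<gamma> t" "t \<in> {0..1}" by blast
        have "t \<noteq> 0" "t \<noteq> 1" using x t ends by (auto simp: pathstart_def pathfinish_def)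
        then have "t \<in> {0<..<1}" using t(2) by auto
        then show "x \<in> E" using t(1) img by blast
      qed
    qed
    then have "closedin (top_of_set ?X) E"
      by (metis cont closedin_closed_Int compact_Icc compact_continuous_image compact_imp_closed)
    moreover have "E \<noteq> {}" using img by force
    ultimately show ?thesis using sub by blast
  qed
  have opn: "openin (top_of_set ?X) E" if E: "E \<in> \<E>" for E
  proof -
    have "closedin (top_of_set ?X) (\<Union>(\<E> - {E}))"
      using fin props by (intro closedin_Union) auto
    moreover have "E = ?X - \<Union>(\<E> - {E})"
      using un E dis by (auto simp: disjoint_def)
    ultimately show ?thesis
      by (metis openin_diff openin_subtopology_self)
  qed
  have eq: "C = E" if C: "C \<in> components ?X" and E: "E \<in> \<E>" and meet: "C \<inter> E \<noteq> {}" for C E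
  proof -
    have CX: "C \<subseteq> ?X" and conC: "connected C"
      using C in_components_subset in_components_connected by auto
    have "E \<subseteq> C"
      using components_maximal[OF C] props[OF E] meet by blast
    then have "openin (top_of_set C) E" "closedin (top_of_set C) E"
      using opn[OF E] props[OF E] CX
      by (auto intro: openin_subset_trans closedin_subset_trans)
    then show ?thesis
      using conC props[OF E] connected_clopen by blast
  qed
  show ?thesis
    unfolding open_edges_def
  proof
    show "components ?X \<subseteq> \<E>"
    proof
      fix C assume C: "C \<in> components ?X"
      then obtain x where "x \<in> C" "x \<in> ?X"
        using in_components_nonempty in_components_subset by blast
      then obtain E where "E \<in> \<E>" "x \<in> E" using un by blast
      then show "C \<in> \<E>" using eq[OF C] \<open>x \<in> C\<close> by blast
    qed
    show "\<E> \<subseteq> components ?X"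
    proof
      fix E assume E: "E \<in> \<E>"
      then obtain x where x: "x \<in> E" "x \<in> ?X" using props by blast
      then obtain C where C: "C \<in> components ?X" "x \<in> C"
        using Union_components by blast
      then show "E \<in> components ?X" using eq[OF C(1) E] x by blast
    qed
  qed
qed


section \<open>Height functions, critical points and indices\<close>

definition height :: "real^3 \<Rightarrow> real^3 \<Rightarrow> real" where
  "height u x = u \<bullet> x"

definition limit_directions :: "(real^3) set \<Rightarrow> real^3 \<Rightarrow> (real^3) set" where
  "limit_directions \<Gamma> p =
     {\<tau>. \<exists>q. (\<forall>k::nat. q k \<in> \<Gamma> - {p}) \<and> q \<longlonglongrightarrow> p \<and>
             (\<lambda>k. (q k - p) /\<^sub>R norm (q k - p)) \<longlonglongrightarrow> \<tau>}"

text \<open>Neither notion depends on the regular parametrisation of the arc.\<close>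

definition critical_point :: "(real^3 \<Rightarrow> real) \<Rightarrow> (real^3) set \<Rightarrow> real^3 \<Rightarrow> bool" where
  "critical_point h E p \<longleftrightarrow>
     (\<exists>\<gamma>. \<exists>t\<in>{0<..<1}. arc_param \<gamma> E \<and> \<gamma> t = p \<and> deriv (h \<circ> \<gamma>) t = 0)"

definition nondegenerate_critical_point :: "(real^3 \<Rightarrow> real) \<Rightarrow> (real^3) set \<Rightarrow> real^3 \<Rightarrow> bool" where
  "nondegenerate_critical_point h E p \<longleftrightarrow>
     (\<exists>\<gamma>. \<exists>t\<in>{0<..<1}. arc_param \<gamma> E \<and> \<gamma> t = p \<and>
        deriv (h \<circ> \<gamma>) t = 0 \<and> deriv (deriv (h \<circ> \<gamma>)) t \<noteq> 0)"

definition nondegenerate_direction :: "(real^3) set \<Rightarrow> (real^3) set \<Rightarrow> real^3 \<Rightarrow> bool" where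
  "nondegenerate_direction \<Gamma> V u \<longleftrightarrow>
     u \<in> sphere 0 1 \<and>
     (\<forall>E\<in>open_edges \<Gamma> V. \<forall>p\<in>E.
        critical_point (height u) E p \<longrightarrow> nondegenerate_critical_point (height u) E p) \<and>
     (\<forall>v\<in>V. \<forall>\<tau>\<in>limit_directions \<Gamma> v. u \<bullet> \<tau> \<noteq> 0)"

definition d_minus :: "(real^3) set \<Rightarrow> real^3 \<Rightarrow> real^3 \<Rightarrow> nat" where
  "d_minus \<Gamma> p u =
     (THE n. \<forall>\<^sub>F \<epsilon> in at_right 0.
        finite {q\<in>\<Gamma>. dist p q = \<epsilon> \<and> height u q < height u p} \<and>
        card {q\<in>\<Gamma>. dist p q = \<epsilon> \<and> height u q < height u p} = n)"

definition stratified_critical_points ::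
    "(real^3) set \<Rightarrow> (real^3) set \<Rightarrow> real^3 \<Rightarrow> (real^3) set" where
  "stratified_critical_points \<Gamma> V u =
     V \<union> {p. \<exists>E\<in>open_edges \<Gamma> V. p \<in> E \<and> critical_point (height u) E p}"

definition local_minimum_on :: "(real^3 \<Rightarrow> real) \<Rightarrow> (real^3) set \<Rightarrow> real^3 \<Rightarrow> bool" where
  "local_minimum_on h \<Gamma> p \<longleftrightarrow> p \<in> \<Gamma> \<and> (\<forall>\<^sub>F q in at p within \<Gamma>. h p \<le> h q)"

definition weight :: "(real^3) set \<Rightarrow> real^3 \<Rightarrow> real^3 \<Rightarrow> int" where
  "weight \<Gamma> p u =
     (if local_minimum_on (height u) \<Gamma> p then 1 else int (d_minus \<Gamma> p u) - 1)"

definition total_weight :: "(real^3) set \<Rightarrow> (real^3) set \<Rightarrow> real^3 \<Rightarrow> int" where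
  "total_weight \<Gamma> V u = (\<Sum>p\<in>stratified_critical_points \<Gamma> V u. weight \<Gamma> p u)"


section \<open>Area on the unit sphere and total curvature\<close>

definition spherical :: "real \<times> real \<Rightarrow> real^3" where
  "spherical = (\<lambda>(\<theta>, \<phi>). vector [sin \<theta> * cos \<phi>, sin \<theta> * sin \<phi>, cos \<theta>])"

text \<open>The area element is \<open>sin \<theta> d\<theta> d\<phi>\<close>. The measure lives on the whole space, is
  concentrated on the unit sphere, and is completed.\<close>

definition sphere_area :: "(real^3) measure" where
  "sphere_area =
     completion (distr
       (density lborel (\<lambda>(\<theta>, \<phi>). ennreal (indicator ({0..pi} \<times> {0..2*pi}) (\<theta>, \<phi>) * sin \<theta>)))
       borel spherical)"

lemma continuous_spherical: "continuous_on UNIV spherical"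
proof -
  have "spherical = (\<lambda>p. (sin (fst p) * cos (snd p)) *\<^sub>R axis 1 1
      + (sin (fst p) * sin (snd p)) *\<^sub>R axis 2 1 + cos (fst p) *\<^sub>R axis 3 1)"
    by (auto simp: fun_eq_iff spherical_def vec_eq_iff forall_3 vector_3 axis_def)
  moreover have "continuous_on UNIV \<dots>"
    by (intro continuous_intros)
  ultimately show ?thesis by metis
qed

lemma spherical_measurable [measurable]: "spherical \<in> borel_measurable borel"
  by (rule borel_measurable_continuous_onI) (rule continuous_spherical)

lemma spherical_in_sphere: "spherical p \<in> sphere 0 1"
proof -
  have "(sin a * cos b)\<^sup>2 + (sin a * sin b)\<^sup>2 + (cos a)\<^sup>2 = 1" for a b :: real
    by (metis (no_types) sin_cos_squared_add2 power_mult_distrib distrib_left mult.right_neutral sin_cos_squared_add add.commute)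
  then show ?thesis
    by (cases p) (simp add: spherical_def norm_vec_def L2_set_def sum_3 vector_3 case_prod_beta)
qed

lemma emeasure_sphere_area_sphere: "emeasure sphere_area (sphere 0 1) = ennreal (4 * pi)"
proof -
  have m [measurable]: "(\<lambda>(\<theta>, \<phi>). ennreal (indicator ({0..pi} \<times> {0..2*pi}) (\<theta>, \<phi>) * sin \<theta>))
     \<in> borel_measurable (borel \<Otimes>\<^sub>M borel)" by measurable
  have I: "(\<integral>\<^sup>+\<theta>. ennreal (indicator {0..pi} \<theta> * sin \<theta>) \<partial>lborel) = ennreal 2"
  proof -
    have "(\<integral>\<^sup>+\<theta>. ennreal (sin \<theta>) * indicator {0..pi} \<theta> \<partial>lborel) = ennreal (- cos pi - (- cos 0))"
      by (rule nn_integral_FTC_Icc) (auto intro!: derivative_eq_intros sin_ge_zero)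
    moreover have "ennreal (sin \<theta>) * indicator {0..pi} \<theta> = ennreal (indicator {0..pi} \<theta> * sin \<theta>)" for \<theta>
      by (auto simp: indicator_def)
    ultimately show ?thesis by simp
  qed
  have "emeasure sphere_area (sphere 0 1) =
      (\<integral>\<^sup>+p. (\<lambda>(\<theta>, \<phi>). ennreal (indicator ({0..pi} \<times> {0..2*pi}) (\<theta>, \<phi>) * sin \<theta>)) p \<partial>lborel)"
  proof -
    have "spherical -` sphere 0 1 = UNIV" using spherical_in_sphere by auto
    then show ?thesis
      unfolding sphere_area_def
      by (subst emeasure_completion) (use m in \<open>auto simp: emeasure_distr emeasure_density borel_prod\<close>)
  qed
  also have "\<dots> = (\<integral>\<^sup>+\<theta>. \<integral>\<^sup>+\<phi>. ennreal (indicator {0..pi} \<theta> * sin \<theta>) * indicator {0..2*pi} \<phi> \<partial>lborel \<partial>lborel)"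
    unfolding lborel_prod[symmetric]
    by (subst lborel.nn_integral_fst[symmetric])
       (auto intro!: nn_integral_cong simp: indicator_def)
  also have "\<dots> = (\<integral>\<^sup>+\<theta>. ennreal (indicator {0..pi} \<theta> * sin \<theta>) * ennreal (2 * pi) \<partial>lborel)"
    by (simp add: nn_integral_cmult_indicator)
  also have "\<dots> = ennreal 2 * ennreal (2 * pi)"
    by (subst nn_integral_multc) (auto simp: I)
  finally show ?thesis by (simp add: ennreal_mult[symmetric] flip: ennreal_numeral)
qed

text \<open>The weight is integrated over the nondegenerate directions, where it is defined; these have
  full measure in the unit sphere.\<close>

definition total_curvature :: "(real^3) set \<Rightarrow> (real^3) set \<Rightarrow> real" where
  "total_curvature \<Gamma> V =
     1 / (4 * pi) *
     (LINT u:{u. nondegenerate_direction \<Gamma> V u}|sphere_area. real_of_int (total_weight \<Gamma> V u))"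

end

theory Submission
  imports Defs
begin

text \<open>The integrand defining the total curvature depends on the vertex set in two ways: through the
  points that are summed over, and through the set of nondegenerate directions. Both effects are
  controlled by one observation: at a point \<open>p\<close> of an open edge, whether \<open>p\<close> is critical for
  \<open>h\<^sub>u\<close>, and if so whether it is nondegenerate, can be read off from \<open>\<Gamma>\<close> alone, without any
  reference to the edge or to a parametrisation. Since an edge is open in \<open>\<Gamma>\<close> and its
  parametrisation is a homeomorphism onto its image, limits along the parameter are the same as limits
  for \<open>q \<rightarrow> p\<close> in \<open>\<Gamma>\<close>; by Taylor expansion \<open>p\<close> is critical iff \<open>(h\<^sub>u(q) - h\<^sub>u(p)) / |q - p|\<close>
  tends to \<open>0\<close>, and a critical \<open>p\<close> is degenerate iff \<open>(h\<^sub>u(q) - h\<^sub>u(p)) / |q - p|\<^sup>2\<close> tends to \<open>0\<close>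
  (\<open>critical_point_iff_slope\<close> and \<open>nondegenerate_critical_point_iff_curvature\<close>).

  Consequently a point that is stratified critical for \<open>V\<close> but not for \<open>V'\<close> must be a vertex in
  \<open>V\<close> that is a noncritical interior point of an edge of \<open>V'\<close>. Near such a point the height is
  strictly monotone along the curve, so small spheres meet exactly one branch below \<open>p\<close> and the weight
  is \<open>1 - 1 = 0\<close> (\<open>weight_eq_0\<close>). Hence the total weights for \<open>V\<close> and \<open>V'\<close> agree for
  every direction (\<open>total_weight_vertex_independent\<close>).

  The nondegeneracy conditions for \<open>V\<close> and \<open>V'\<close> can differ only at points that are vertices of exactly
  one of the two graphs. Such a point lies inside an edge of the other graph, and the conditions can
  disagree there only for directions orthogonal to the tangent of that edge
  (\<open>nondegenerate_direction_transfer\<close>). The exceptional directions therefore lie on finitely many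
  great circles, which have area \<open>0\<close> (\<open>great_circle_null\<close>), and the two integrals coincide.\<close>


section \<open>Power series are twice differentiable\<close>

lemma power_series_twice_differentiable:
  fixes g :: "real \<Rightarrow> real"
  assumes r: "r > 0" and sums: "\<And>s. \<bar>s - t\<bar> < r \<Longrightarrow> (\<lambda>n. c n * (s - t) ^ n) sums g s"
  shows "\<exists>g' g''. (\<forall>s. \<bar>s - t\<bar> < r \<longrightarrow> (g has_real_derivative g' s) (at s)) \<and>
                  (g' has_real_derivative g'') (at t)"
proof -
  have summ: "summable (\<lambda>n. c n * x ^ n)" if "norm x < r" for x
    using sums[of "x + t"] that by (auto simp: sums_iff)
  have summ': "summable (\<lambda>n. diffs c n * x ^ n)" if "norm x < r" for x
    using termdiff_converges[OF that summ] .
  define G where "G = (\<lambda>x. \<Sum>n. c n * x ^ n)"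
  define G' where "G' = (\<lambda>x. \<Sum>n. diffs c n * x ^ n)"
  have G: "(G has_real_derivative G' x) (at x)" if "norm x < r" for x
    unfolding G_def G'_def using summ that by (rule termdiffs_strong')
  have G': "(G' has_real_derivative (\<Sum>n. diffs (diffs c) n * 0 ^ n)) (at 0)"
    unfolding G'_def by (rule termdiffs_strong'[OF summ']) (use r in auto)
  have "(g has_real_derivative G' (s - t)) (at s)" if s: "\<bar>s - t\<bar> < r" for s
  proof -
    have "((\<lambda>s. G (s - t)) has_real_derivative G' (s - t)) (at s)"
      using G[of "s - t"] s DERIV_shift[of G "G' (s - t)" s "-t"] by simp
    moreover have "\<forall>\<^sub>F x in nhds s. \<bar>x - t\<bar> < r"
      by (rule eventually_nhds_in_open[of "{x. \<bar>x - t\<bar> < r}", simplified])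
         (use s in \<open>auto intro!: open_Collect_less continuous_intros\<close>)
    then have "\<forall>\<^sub>F x in nhds s. G (x - t) = g x"
      by eventually_elim (use sums in \<open>auto simp: G_def sums_iff\<close>)
    ultimately show ?thesis
      by (subst (asm) DERIV_cong_ev) auto
  qed
  moreover have "((\<lambda>s. G' (s - t)) has_real_derivative (\<Sum>n. diffs (diffs c) n * 0 ^ n)) (at t)"
    using G' DERIV_shift[of G' "\<Sum>n. diffs (diffs c) n * 0 ^ n" t "-t"] by simp
  ultimately show ?thesis
    by (intro exI[of _ "\<lambda>s. G' (s - t)"] exI[of _ "\<Sum>n. diffs (diffs c) n * 0 ^ n"]) blast
qed

text \<open>The components of \<open>f\<close> are sums of scalar power series with a common radius of convergence.
  The derivative \<open>f'\<close> is obtained near \<open>t\<close>, but \<open>f''\<close> only at \<open>t\<close>, which is all that second-order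
  Taylor expansion at \<open>t\<close> needs.\<close>

lemma real_analytic_at_twice_differentiable:
  fixes f :: "real \<Rightarrow> 'a::euclidean_space"
  assumes "real_analytic_at f t"
  obtains f' f'' where "\<forall>\<^sub>F s in nhds t. (f has_vector_derivative f' s) (at s)"
    and "(f' has_vector_derivative f'') (at t)"
proof -
  obtain r a where r: "r > 0"
    and sums: "\<And>s. \<bar>s - t\<bar> < r \<Longrightarrow> (\<lambda>n. (s - t) ^ n *\<^sub>R a n) sums f s"
    using assms unfolding real_analytic_at_def by metis
  have "\<exists>g' g''. (\<forall>s. \<bar>s - t\<bar> < r \<longrightarrow> ((\<lambda>s. f s \<bullet> b) has_real_derivative g' s) (at s)) \<and>
          (g' has_real_derivative g'') (at t)" for b
  proof (rule power_series_twice_differentiable[OF r])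
    fix s assume "\<bar>s - t\<bar> < r"
    from bounded_linear.sums[OF bounded_linear_inner_left sums[OF this], of b]
    show "(\<lambda>n. (a n \<bullet> b) * (s - t) ^ n) sums (f s \<bullet> b)" by (simp add: mult.commute)
  qed
  then obtain g' g'' where
      g': "\<And>b s. \<bar>s - t\<bar> < r \<Longrightarrow> ((\<lambda>s. f s \<bullet> b) has_real_derivative g' b s) (at s)"
    and g'': "\<And>b. (g' b has_real_derivative g'' b) (at t)"
    by metis
  show thesis
  proof
    have "(f has_vector_derivative (\<Sum>b\<in>Basis. g' b s *\<^sub>R b)) (at s)" if "\<bar>s - t\<bar> < r" for s
    proof -
      have "((\<lambda>s. \<Sum>b\<in>Basis. (f s \<bullet> b) *\<^sub>R b) has_vector_derivative (\<Sum>b\<in>Basis. g' b s *\<^sub>R b)) (at s)"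
        by (auto intro!: derivative_eq_intros g'[OF that])
      then show ?thesis by (simp add: euclidean_representation)
    qed
    moreover have "\<forall>\<^sub>F x in nhds t. \<bar>x - t\<bar> < r"
      by (rule eventually_nhds_in_open[of "{x. \<bar>x - t\<bar> < r}", simplified])
         (use r in \<open>auto intro!: open_Collect_less continuous_intros\<close>)
    ultimately show "\<forall>\<^sub>F s in nhds t. (f has_vector_derivative (\<Sum>b\<in>Basis. g' b s *\<^sub>R b)) (at s)"
      by (auto elim: eventually_mono)
    show "((\<lambda>s. \<Sum>b\<in>Basis. g' b s *\<^sub>R b) has_vector_derivative (\<Sum>b\<in>Basis. g'' b *\<^sub>R b)) (at t)"
      by (auto intro!: derivative_eq_intros g'')
  qed
qed


section \<open>Critical points on an open arc in terms of the surrounding set\<close>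

text \<open>An edge \<open>E\<close> that is open in \<open>\<Gamma>\<close>, seen from one of its points. The set \<open>\<Gamma>\<close> is part of
  the context because every local property of the edge at this point is to be restated as a property
  of \<open>\<Gamma>\<close>.\<close>

locale open_arc =
  fixes \<Gamma> E :: "(real^3) set" and \<gamma> :: "real \<Rightarrow> real^3" and t :: real
  assumes param: "arc_param \<gamma> E" and opn: "openin (top_of_set \<Gamma>) E" and t: "t \<in> {0<..<1}"
begin

abbreviation "p \<equiv> \<gamma> t"

abbreviation "velocity \<equiv> vector_derivative \<gamma> (at t)"

lemma velocity_nonzero: "velocity \<noteq> 0"
  using param t by (auto simp: arc_param_def)

text \<open>This identification of filters is what removes the parametrisation: any limit along the
  parameter becomes a limit over points of \<open>\<Gamma>\<close>. It rests on the inverse of the parametrisation being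
  continuous, by compactness of the closed parameter interval, and on \<open>E\<close> being all of \<open>\<Gamma>\<close> near
  \<open>p\<close>.\<close>

lemma filtermap_param: "filtermap \<gamma> (at t) = at p within \<Gamma>"
proof (rule filtermap_fun_inverse)
  have cont: "continuous_on {0..1} \<gamma>" and inj: "inj_on \<gamma> {0..1}" and img: "\<gamma> ` {0<..<1} = E"
    using param by (auto simp: arc_param_def arc_def path_def)
  have E_sub: "E \<subseteq> \<gamma> ` {0..1}" using img by force
  have p_E: "p \<in> E" using img t by blast
  obtain O' where O': "open O'" "E = \<Gamma> \<inter> O'"
    using opn by (auto simp: openin_open)
  have at_E: "at p within \<Gamma> = at p within E"
    using O' p_E by (intro at_within_nhd[of _ O']) auto
  have ev_t: "\<forall>\<^sub>F s in at t. s \<in> {0<..<1}"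
    using t by (intro eventually_at_in_open') auto
  define g where "g = the_inv_into {0..1} \<gamma>"
  have g_\<gamma>: "g (\<gamma> s) = s" if "s \<in> {0..1}" for s
    unfolding g_def using inj that by (rule the_inv_into_f_f)
  have g_cont: "continuous_on E g"
    unfolding g_def
    by (rule continuous_on_subset[OF continuous_on_inv_into[OF cont compact_Icc inj] E_sub])
  have evE: "\<forall>\<^sub>F q in at p within \<Gamma>. q \<in> E - {p}"
    unfolding at_E eventually_at_filter by simp
  show "filterlim g (at t) (at p within \<Gamma>)"
  proof (rule filterlim_atI)
    have "(g \<longlongrightarrow> g p) (at p within E)"
      using g_cont p_E by (auto simp: continuous_on_def)
    then show "(g \<longlongrightarrow> t) (at p within \<Gamma>)"
      using t by (simp add: at_E g_\<gamma>)
    show "\<forall>\<^sub>F q in at p within \<Gamma>. g q \<noteq> t"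
      using evE
    proof eventually_elim
      case (elim q)
      then obtain s where "q = \<gamma> s" "s \<in> {0<..<1}" using img by blast
      then show ?case using elim g_\<gamma>[of s] by auto
    qed
  qed
  show "\<forall>\<^sub>F q in at p within \<Gamma>. \<gamma> (g q) = q"
    using evE
  proof eventually_elim
    case (elim q)
    then obtain s where "q = \<gamma> s" "s \<in> {0<..<1}" using img by blast
    then show ?case using g_\<gamma>[of s] by auto
  qed
  show "filterlim \<gamma> (at p within \<Gamma>) (at t)"
    unfolding filterlim_at
  proof
    have "\<forall>\<^sub>F s in at t. s \<in> {0<..<1} \<and> s \<noteq> t"
      using ev_t eventually_neq_at_within by (rule eventually_conj)
    then show "\<forall>\<^sub>F s in at t. \<gamma> s \<in> \<Gamma> \<and> \<gamma> s \<noteq> p"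
    proof eventually_elim
      case (elim s)
      then have "\<gamma> s \<in> E" using img by blast
      moreover have "\<gamma> s \<noteq> p"
        using elim t inj by (auto simp: inj_on_def)
      ultimately show ?case using O' by auto
    qed
    have "continuous (at t) \<gamma>"
      using continuous_on_interior[OF cont, of t] t by simp
    then show "(\<gamma> \<longlongrightarrow> p) (at t)" by (simp add: isCont_def)
  qed
qed

lemma not_isolated: "at p within \<Gamma> \<noteq> bot"
  using filtermap_param by (metis filtermap_bot_iff at_neq_bot)

lemma derivatives:
  obtains \<gamma>' \<gamma>'' where "\<forall>\<^sub>F s in nhds t. (\<gamma> has_vector_derivative \<gamma>' s) (at s)"
    and "(\<gamma>' has_vector_derivative \<gamma>'') (at t)" and "\<gamma>' t = velocity"
proof -
  have "real_analytic_at \<gamma> t" using param t by (simp add: arc_param_def)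
  then obtain \<gamma>' \<gamma>'' where d: "\<forall>\<^sub>F s in nhds t. (\<gamma> has_vector_derivative \<gamma>' s) (at s)"
    "(\<gamma>' has_vector_derivative \<gamma>'') (at t)"
    by (rule real_analytic_at_twice_differentiable)
  have "(\<gamma> has_vector_derivative \<gamma>' t) (at t)"
    using d(1) by (rule eventually_nhds_x_imp_x)
  then have "\<gamma>' t = velocity" by (simp add: vector_derivative_at)
  with d that show thesis by blast
qed

lemma has_velocity: "(\<gamma> has_vector_derivative velocity) (at t)"
  using derivatives by (metis eventually_nhds_x_imp_x)

lemma secant_tendsto: "((\<lambda>s. (\<gamma> s - p) /\<^sub>R (s - t)) \<longlongrightarrow> velocity) (at t)"
proof -
  have "((\<lambda>s. norm (\<gamma> s - p - (s - t) *\<^sub>R velocity) / norm (s - t)) \<longlongrightarrow> 0) (at t)"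
    using has_velocity by (simp add: has_vector_derivative_def has_derivative_iff_norm)
  moreover have "\<forall>\<^sub>F s in at t. norm (\<gamma> s - p - (s - t) *\<^sub>R velocity) / norm (s - t) =
      norm ((\<gamma> s - p) /\<^sub>R (s - t) - velocity)"
    using eventually_neq_at_within[of t]
  proof eventually_elim
    case (elim s)
    then have "(\<gamma> s - p) /\<^sub>R (s - t) - velocity = (\<gamma> s - p - (s - t) *\<^sub>R velocity) /\<^sub>R (s - t)"
      by (simp add: scaleR_diff_right)
    then show ?case by (simp add: divide_inverse mult.commute)
  qed
  ultimately have "((\<lambda>s. norm ((\<gamma> s - p) /\<^sub>R (s - t) - velocity)) \<longlongrightarrow> 0) (at t)"
    by (rule Lim_transform_eventually)
  then show ?thesis by (simp add: tendsto_norm_zero_iff LIM_zero_iff)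
qed

lemma deriv_height: "deriv (height u \<circ> \<gamma>) t = u \<bullet> velocity"
proof -
  have "((\<lambda>s. u \<bullet> \<gamma> s) has_vector_derivative u \<bullet> velocity) (at t)"
    by (rule bounded_linear.has_vector_derivative[OF bounded_linear_inner_right has_velocity])
  then show ?thesis
    by (auto simp: height_def o_def has_real_derivative_iff_has_vector_derivative intro!: DERIV_imp_deriv)
qed

text \<open>The absolute value makes the limit two-sided: the sign of the difference quotient changes as
  \<open>q\<close> passes from one branch of the curve at \<open>p\<close> to the other.\<close>

lemma slope_tendsto:
  "((\<lambda>q. \<bar>u \<bullet> (q - p)\<bar> / norm (q - p)) \<longlongrightarrow> \<bar>u \<bullet> velocity\<bar> / norm velocity) (at p within \<Gamma>)"
  unfolding filtermap_param[symmetric] filterlim_filtermap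
proof (rule Lim_transform_eventually)
  show "((\<lambda>s. \<bar>u \<bullet> ((\<gamma> s - p) /\<^sub>R (s - t))\<bar> / norm ((\<gamma> s - p) /\<^sub>R (s - t)))
          \<longlongrightarrow> \<bar>u \<bullet> velocity\<bar> / norm velocity) (at t)"
    by (intro tendsto_intros secant_tendsto) (use velocity_nonzero in auto)
  show "\<forall>\<^sub>F s in at t. \<bar>u \<bullet> ((\<gamma> s - p) /\<^sub>R (s - t))\<bar> / norm ((\<gamma> s - p) /\<^sub>R (s - t)) =
          \<bar>u \<bullet> (\<gamma> s - p)\<bar> / norm (\<gamma> s - p)"
    using eventually_neq_at_within[of t]
    by eventually_elim (auto simp: abs_mult divide_simps)
qed

text \<open>At a critical point the numerator is
  \<open>(1/2) (h\<^sub>u \<circ> \<gamma>)''(t) (s - t)\<^sup>2 + o((s - t)\<^sup>2)\<close>, and the squared distance is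
  \<open>|\<gamma>'(t)|\<^sup>2 (s - t)\<^sup>2 + o((s - t)\<^sup>2)\<close>.\<close>

lemma curvature_tendsto:
  assumes crit: "u \<bullet> velocity = 0"
  shows "((\<lambda>q. u \<bullet> (q - p) / (norm (q - p))\<^sup>2) \<longlongrightarrow>
            deriv (deriv (height u \<circ> \<gamma>)) t / (2 * (norm velocity)\<^sup>2)) (at p within \<Gamma>)"
proof -
  obtain \<gamma>' \<gamma>'' where d1: "\<forall>\<^sub>F s in nhds t. (\<gamma> has_vector_derivative \<gamma>' s) (at s)"
    and d2: "(\<gamma>' has_vector_derivative \<gamma>'') (at t)" and vel: "\<gamma>' t = velocity"
    by (rule derivatives)
  have g1: "\<forall>\<^sub>F s in nhds t. ((\<lambda>s. u \<bullet> \<gamma> s) has_real_derivative u \<bullet> \<gamma>' s) (at s)"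
    using d1 by eventually_elim
      (auto simp: has_real_derivative_iff_has_vector_derivative
            intro: bounded_linear.has_vector_derivative[OF bounded_linear_inner_right])
  have g2: "((\<lambda>s. u \<bullet> \<gamma>' s) has_real_derivative u \<bullet> \<gamma>'') (at t)"
    using d2 by (auto simp: has_real_derivative_iff_has_vector_derivative
            intro: bounded_linear.has_vector_derivative[OF bounded_linear_inner_right])
  have "\<forall>\<^sub>F s in nhds t. deriv (height u \<circ> \<gamma>) s = u \<bullet> \<gamma>' s"
    using g1 by eventually_elim (auto simp: height_def o_def DERIV_imp_deriv)
  then have dd: "deriv (deriv (height u \<circ> \<gamma>)) t = u \<bullet> \<gamma>''"
    using g2 by (metis deriv_cong_ev DERIV_imp_deriv)
  have quot: "((\<lambda>s. (u \<bullet> (\<gamma> s - p)) / (s - t)\<^sup>2) \<longlongrightarrow> u \<bullet> \<gamma>'' / 2) (at t)"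
  proof (rule lhopital)
    have "isCont (\<lambda>s. u \<bullet> \<gamma> s) t"
      using eventually_nhds_x_imp_x[OF g1] by (rule DERIV_isCont)
    then show "((\<lambda>s. u \<bullet> (\<gamma> s - p)) \<longlongrightarrow> 0) (at t)"
      by (simp add: isCont_def inner_diff_right LIM_zero_iff)
    have "((\<lambda>s. (s - t)\<^sup>2) \<longlongrightarrow> (t - t)\<^sup>2) (at t)" by (intro tendsto_intros)
    then show "((\<lambda>s. (s - t)\<^sup>2) \<longlongrightarrow> 0) (at t)" by simp
    show "\<forall>\<^sub>F s in at t. (s - t)\<^sup>2 \<noteq> 0" "\<forall>\<^sub>F s in at t. 2 * (s - t) \<noteq> 0"
      using eventually_neq_at_within[of t] by (auto elim: eventually_mono)
    show "\<forall>\<^sub>F s in at t. ((\<lambda>s. u \<bullet> (\<gamma> s - p)) has_real_derivative u \<bullet> \<gamma>' s) (at s)"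
      using g1 unfolding eventually_at_filter
      by eventually_elim (auto simp: inner_diff_right intro!: derivative_eq_intros)
    show "\<forall>\<^sub>F s in at t. ((\<lambda>s. (s - t)\<^sup>2) has_real_derivative 2 * (s - t)) (at s)"
      by (auto intro!: always_eventually derivative_eq_intros)
    have "((\<lambda>s. (u \<bullet> \<gamma>' s - u \<bullet> \<gamma>' t) / (s - t)) \<longlongrightarrow> u \<bullet> \<gamma>'') (at t)"
      using g2 by (simp add: has_field_derivative_iff)
    from tendsto_divide[OF this tendsto_const[of 2]]
    show "((\<lambda>s. u \<bullet> \<gamma>' s / (2 * (s - t))) \<longlongrightarrow> u \<bullet> \<gamma>'' / 2) (at t)"
      by (simp add: vel crit mult.commute)
  qed
  show ?thesis
    unfolding filtermap_param[symmetric] filterlim_filtermap dd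
  proof (rule Lim_transform_eventually)
    have "((\<lambda>s. ((u \<bullet> (\<gamma> s - p)) / (s - t)\<^sup>2) / (norm ((\<gamma> s - p) /\<^sub>R (s - t)))\<^sup>2)
            \<longlongrightarrow> (u \<bullet> \<gamma>'' / 2) / (norm velocity)\<^sup>2) (at t)"
      by (intro tendsto_intros secant_tendsto quot) (use velocity_nonzero in auto)
    then show "((\<lambda>s. ((u \<bullet> (\<gamma> s - p)) / (s - t)\<^sup>2) / (norm ((\<gamma> s - p) /\<^sub>R (s - t)))\<^sup>2)
            \<longlongrightarrow> u \<bullet> \<gamma>'' / (2 * (norm velocity)\<^sup>2)) (at t)"
      by simp
    show "\<forall>\<^sub>F s in at t. ((u \<bullet> (\<gamma> s - p)) / (s - t)\<^sup>2) / (norm ((\<gamma> s - p) /\<^sub>R (s - t)))\<^sup>2 =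
          u \<bullet> (\<gamma> s - p) / (norm (\<gamma> s - p))\<^sup>2"
      using eventually_neq_at_within[of t]
      by eventually_elim (auto simp: power_mult_distrib power_inverse divide_simps)
  qed
qed

lemma slope_tendsto_0_iff:
  "((\<lambda>q. \<bar>u \<bullet> (q - p)\<bar> / norm (q - p)) \<longlongrightarrow> 0) (at p within \<Gamma>) \<longleftrightarrow> u \<bullet> velocity = 0"
  using tendsto_unique[OF not_isolated slope_tendsto[of u], of 0] slope_tendsto[of u] velocity_nonzero
  by auto

lemma curvature_tendsto_0_iff:
  assumes "u \<bullet> velocity = 0"
  shows "((\<lambda>q. u \<bullet> (q - p) / (norm (q - p))\<^sup>2) \<longlongrightarrow> 0) (at p within \<Gamma>) \<longleftrightarrow>
           deriv (deriv (height u \<circ> \<gamma>)) t = 0"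
  using tendsto_unique[OF not_isolated curvature_tendsto[OF assms], of 0] curvature_tendsto[OF assms]
    velocity_nonzero
  by auto

text \<open>Inside an arc the limit directions are the two unit tangents. Only their inner products with
  \<open>u\<close> matter here, and these come directly from the limit of the slopes.\<close>

lemma inner_limit_direction:
  assumes "\<tau> \<in> limit_directions \<Gamma> p"
  shows "\<bar>u \<bullet> \<tau>\<bar> = \<bar>u \<bullet> velocity\<bar> / norm velocity"
proof -
  obtain q :: "nat \<Rightarrow> real^3" where q: "\<And>k. q k \<in> \<Gamma> - {p}" "q \<longlonglongrightarrow> p"
    and \<tau>: "(\<lambda>k. (q k - p) /\<^sub>R norm (q k - p)) \<longlonglongrightarrow> \<tau>"
    using assms by (auto simp: limit_directions_def)
  have "filterlim q (at p within \<Gamma>) sequentially"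
    using q by (auto simp: filterlim_at intro!: always_eventually)
  then have lim: "(\<lambda>k. \<bar>u \<bullet> (q k - p)\<bar> / norm (q k - p)) \<longlonglongrightarrow> \<bar>u \<bullet> velocity\<bar> / norm velocity"
    by (rule filterlim_compose[OF slope_tendsto])
  have "(\<lambda>k. \<bar>u \<bullet> ((q k - p) /\<^sub>R norm (q k - p))\<bar>) \<longlonglongrightarrow> \<bar>u \<bullet> \<tau>\<bar>"
    by (intro tendsto_intros \<tau>)
  then have "(\<lambda>k. \<bar>u \<bullet> (q k - p)\<bar> / norm (q k - p)) \<longlonglongrightarrow> \<bar>u \<bullet> \<tau>\<bar>"
    by (simp add: abs_mult divide_inverse mult.commute)
  from LIMSEQ_unique[OF this lim] show ?thesis .
qed


subsection \<open>The weight of a noncritical point\<close>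

text \<open>The curve leaves \<open>p\<close> on both sides with strictly increasing distance, and lies strictly below
  \<open>p\<close> on one side and strictly above on the other. Multiplying by \<open>s - t\<close>, and by \<open>u \<bullet> velocity\<close> for
  the height, puts both sides into a single inequality.\<close>

lemma leaves_monotonically:
  assumes u: "u \<bullet> velocity \<noteq> 0"
  obtains \<gamma>' \<delta> where "\<delta> > 0"
    and "\<And>s. s \<noteq> t \<Longrightarrow> \<bar>s - t\<bar> < \<delta> \<Longrightarrow> (\<gamma> has_vector_derivative \<gamma>' s) (at s)"
    and "\<And>s. s \<noteq> t \<Longrightarrow> \<bar>s - t\<bar> < \<delta> \<Longrightarrow> (u \<bullet> velocity) * (u \<bullet> (\<gamma> s - p)) * (s - t) > 0"
    and "\<And>s. s \<noteq> t \<Longrightarrow> \<bar>s - t\<bar> < \<delta> \<Longrightarrow> ((\<gamma> s - p) \<bullet> \<gamma>' s) * (s - t) > 0"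
    and "\<And>s. s \<noteq> t \<Longrightarrow> \<bar>s - t\<bar> < \<delta> \<Longrightarrow> \<gamma> s \<in> \<Gamma>"
proof -
  obtain \<gamma>' \<gamma>'' where d1: "\<forall>\<^sub>F s in nhds t. (\<gamma> has_vector_derivative \<gamma>' s) (at s)"
    and d2: "(\<gamma>' has_vector_derivative \<gamma>'') (at t)" and vel: "\<gamma>' t = velocity"
    by (rule derivatives)
  have "(\<gamma>' \<longlongrightarrow> velocity) (at t)"
    using has_vector_derivative_continuous[OF d2] vel by (simp add: continuous_within)
  then have "((\<lambda>s. ((\<gamma> s - p) /\<^sub>R (s - t)) \<bullet> \<gamma>' s) \<longlongrightarrow> velocity \<bullet> velocity) (at t)"
    by (intro tendsto_intros secant_tendsto)
  moreover have "velocity \<bullet> velocity > 0"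
    using velocity_nonzero by simp
  ultimately have A: "\<forall>\<^sub>F s in at t. ((\<gamma> s - p) /\<^sub>R (s - t)) \<bullet> \<gamma>' s > 0"
    by (rule order_tendstoD)
  have "((\<lambda>s. (u \<bullet> velocity) * (u \<bullet> ((\<gamma> s - p) /\<^sub>R (s - t)))) \<longlongrightarrow>
            (u \<bullet> velocity) * (u \<bullet> velocity)) (at t)"
    by (intro tendsto_intros secant_tendsto)
  moreover have "(u \<bullet> velocity) * (u \<bullet> velocity) > 0"
    using u by (auto simp: zero_less_mult_iff)
  ultimately have B: "\<forall>\<^sub>F s in at t. (u \<bullet> velocity) * (u \<bullet> ((\<gamma> s - p) /\<^sub>R (s - t))) > 0"
    by (rule order_tendstoD)
  have "\<forall>\<^sub>F q in at p within \<Gamma>. q \<in> \<Gamma>"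
    by (simp add: eventually_at_filter)
  then have C: "\<forall>\<^sub>F s in at t. \<gamma> s \<in> \<Gamma>"
    by (simp add: filtermap_param[symmetric] eventually_filtermap)
  have D: "\<forall>\<^sub>F s in at t. (\<gamma> has_vector_derivative \<gamma>' s) (at s)"
    using d1 by (auto simp: eventually_at_filter elim: eventually_mono)
  have sq: "inverse (s - t) * x > 0 \<Longrightarrow> x * (s - t) > 0" for x s :: real
    by (auto simp: zero_less_mult_iff)
  from A B C D have "\<forall>\<^sub>F s in at t. (\<gamma> has_vector_derivative \<gamma>' s) (at s) \<and>
      (u \<bullet> velocity) * (u \<bullet> (\<gamma> s - p)) * (s - t) > 0 \<and> ((\<gamma> s - p) \<bullet> \<gamma>' s) * (s - t) > 0 \<and> \<gamma> s \<in> \<Gamma>"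
    by eventually_elim (auto intro!: sq simp: mult.left_commute)
  then obtain \<delta> where "\<delta> > 0" and "\<And>s. s \<noteq> t \<Longrightarrow> \<bar>s - t\<bar> < \<delta> \<Longrightarrow> (\<gamma> has_vector_derivative \<gamma>' s) (at s) \<and>
      (u \<bullet> velocity) * (u \<bullet> (\<gamma> s - p)) * (s - t) > 0 \<and> ((\<gamma> s - p) \<bullet> \<gamma>' s) * (s - t) > 0 \<and> \<gamma> s \<in> \<Gamma>"
    unfolding eventually_at dist_real_def by blast
  then show thesis by (intro that[of \<delta> \<gamma>']) blast+
qed

text \<open>Only the side on which the height decreases matters. There the distance to \<open>p\<close> is a
  continuous strictly increasing function of the parameter, so every small radius is attained exactly
  once; and near \<open>p\<close> the two sides make up all of \<open>\<Gamma> - {p}\<close>.\<close>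

lemma unique_lower_point:
  assumes u: "u \<bullet> velocity \<noteq> 0"
  shows "\<forall>\<^sub>F \<epsilon> in at_right 0. \<exists>c. {q \<in> \<Gamma>. dist p q = \<epsilon> \<and> height u q < height u p} = {c}"
proof -
  obtain \<gamma>' \<delta> where \<delta>: "\<delta> > 0"
    and der: "\<And>s. s \<noteq> t \<Longrightarrow> \<bar>s - t\<bar> < \<delta> \<Longrightarrow> (\<gamma> has_vector_derivative \<gamma>' s) (at s)"
    and side: "\<And>s. s \<noteq> t \<Longrightarrow> \<bar>s - t\<bar> < \<delta> \<Longrightarrow> (u \<bullet> velocity) * (u \<bullet> (\<gamma> s - p)) * (s - t) > 0"
    and away: "\<And>s. s \<noteq> t \<Longrightarrow> \<bar>s - t\<bar> < \<delta> \<Longrightarrow> ((\<gamma> s - p) \<bullet> \<gamma>' s) * (s - t) > 0"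
    and in_\<Gamma>: "\<And>s. s \<noteq> t \<Longrightarrow> \<bar>s - t\<bar> < \<delta> \<Longrightarrow> \<gamma> s \<in> \<Gamma>"
    by (rule leaves_monotonically[OF u]) blast
  \<comment> \<open>the side of \<open>t\<close> on which the height is below that of \<open>p\<close>\<close>
  define \<sigma> where "\<sigma> = - sgn (u \<bullet> velocity)"
  have \<sigma>: "\<sigma> * \<sigma> = 1" "\<bar>\<sigma>\<bar> = 1" "\<sigma> \<noteq> 0" and \<sigma>u: "(u \<bullet> velocity) * \<sigma> < 0"
    using u by (auto simp: \<sigma>_def sgn_if)
  define N where "N x = (\<gamma> (t + \<sigma> * x) - p) \<bullet> (\<gamma> (t + \<sigma> * x) - p)" for x
  have N: "(N has_real_derivative 2 * (((\<gamma> (t + \<sigma> * x) - p) \<bullet> \<gamma>' (t + \<sigma> * x)) * \<sigma>)) (at x)"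
    if "0 < x" "x < \<delta>" for x
  proof -
    let ?s = "t + \<sigma> * x"
    have "(\<gamma> has_vector_derivative \<gamma>' ?s) (at ?s)"
      using that \<sigma> by (intro der) (auto simp: abs_mult)
    then have "((\<lambda>x. \<gamma> (t + \<sigma> * x)) has_vector_derivative \<sigma> *\<^sub>R \<gamma>' ?s) (at x)"
      by (intro vector_diff_chain_at[unfolded o_def]) (auto intro!: derivative_eq_intros)
    then have "((\<lambda>x. \<gamma> (t + \<sigma> * x) - p) has_vector_derivative \<sigma> *\<^sub>R \<gamma>' ?s) (at x)"
      by (auto intro!: derivative_eq_intros)
    from bounded_bilinear.has_vector_derivative[OF bounded_bilinear_inner this this]
    show ?thesis
      by (simp add: N_def[abs_def] has_real_derivative_iff_has_vector_derivative inner_commute algebra_simps)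
  qed
  have cont0: "isCont N 0"
  proof -
    have "isCont \<gamma> (t + \<sigma> * 0)"
      using has_vector_derivative_continuous[OF has_velocity] by simp
    moreover have "isCont (\<lambda>x. t + \<sigma> * x) 0"
      by (intro continuous_intros)
    ultimately have "isCont (\<lambda>x. \<gamma> (t + \<sigma> * x)) 0"
      using isCont_o2 by blast
    then show ?thesis
      unfolding N_def[abs_def] by (intro continuous_intros)
  qed
  have cont: "isCont N x" if "0 \<le> x" "x < \<delta>" for x
    using N[of x] that cont0 DERIV_isCont by (cases "x = 0") force+
  have mono: "N x < N y" if "0 \<le> x" "x < y" "y < \<delta>" for x y
  proof (rule DERIV_pos_imp_increasing_open[OF that(2)])
    fix z assume z: "x < z" "z < y"
    let ?s = "t + \<sigma> * z"
    have "((\<gamma> ?s - p) \<bullet> \<gamma>' ?s) * (?s - t) > 0"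
      using that z \<sigma> by (intro away) (auto simp: abs_mult)
    then have "((\<gamma> ?s - p) \<bullet> \<gamma>' ?s) * \<sigma> > 0"
      using that z zero_less_mult_pos2[of "((\<gamma> ?s - p) \<bullet> \<gamma>' ?s) * \<sigma>" z] by (simp add: mult.assoc)
    moreover have "0 < z" "z < \<delta>" using that z by auto
    ultimately show "\<exists>d. (N has_real_derivative d) (at z) \<and> 0 < d"
      by (intro exI[of _ "2 * (((\<gamma> ?s - p) \<bullet> \<gamma>' ?s) * \<sigma>)"]) (simp add: N)
  next
    show "continuous_on {x..y} N"
      using that by (intro continuous_at_imp_continuous_on) (auto intro: cont)
  qed
  have N0: "N 0 = 0" by (simp add: N_def)
  have "\<forall>\<^sub>F s in at t. s \<noteq> t \<and> \<bar>s - t\<bar> < \<delta>"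
    using \<delta> unfolding eventually_at dist_real_def by auto
  then have "\<forall>\<^sub>F q in at p within \<Gamma>. \<exists>s. s \<noteq> t \<and> \<bar>s - t\<bar> < \<delta> \<and> q = \<gamma> s"
    unfolding filtermap_param[symmetric] eventually_filtermap by (auto elim: eventually_mono)
  then obtain \<eta> where \<eta>: "\<eta> > 0"
    and near: "\<And>q. q \<in> \<Gamma> \<Longrightarrow> q \<noteq> p \<Longrightarrow> dist q p < \<eta> \<Longrightarrow> \<exists>s. s \<noteq> t \<and> \<bar>s - t\<bar> < \<delta> \<and> q = \<gamma> s"
    unfolding eventually_at by blast
  \<comment> \<open>below \<open>\<eta>\<close> the sphere meets \<open>\<Gamma>\<close> only in the controlled part of the arc; below the
    second bound the intermediate value theorem applies on \<open>{0..\<delta> / 2}\<close>\<close>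
  define \<rho> where "\<rho> = min \<eta> (sqrt (N (\<delta> / 2)))"
  have "\<rho> > 0" using \<eta> mono[of 0 "\<delta> / 2"] \<delta> by (auto simp: \<rho>_def N0)
  have "\<exists>c. {q \<in> \<Gamma>. dist p q = \<epsilon> \<and> height u q < height u p} = {c}" if \<epsilon>: "0 < \<epsilon>" "\<epsilon> < \<rho>" for \<epsilon>
  proof -
    have "\<epsilon>\<^sup>2 < N (\<delta> / 2)"
      using \<epsilon> real_sqrt_less_iff[of "\<epsilon>\<^sup>2" "N (\<delta> / 2)"] by (simp add: \<rho>_def)
    then obtain x where x: "0 \<le> x" "x \<le> \<delta> / 2" "N x = \<epsilon>\<^sup>2"
      using IVT'[of N 0 "\<epsilon>\<^sup>2" "\<delta> / 2"] \<delta> N0 cont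
      by (force intro!: continuous_at_imp_continuous_on)
    have "x \<noteq> 0" using x(3) N0 \<epsilon> by auto
    with x \<delta> have x': "0 < x" "x < \<delta>" by auto
    have sq_dist: "N y = (dist p (\<gamma> (t + \<sigma> * y)))\<^sup>2" for y
      unfolding N_def dist_norm norm_minus_commute[of p] by (rule power2_norm_eq_inner[symmetric])
    let ?c = "\<gamma> (t + \<sigma> * x)"
    have c: "t + \<sigma> * x \<noteq> t" "\<bar>t + \<sigma> * x - t\<bar> < \<delta>"
      using x' \<sigma> by (auto simp: abs_mult)
    show ?thesis
    proof (intro exI[of _ ?c] set_eqI iffI; clarsimp)
      have "dist p ?c = \<epsilon>"
        using sq_dist[of x] x(3) \<epsilon> by (simp add: power2_eq_iff_nonneg)
      moreover have "((u \<bullet> velocity) * \<sigma>) * (u \<bullet> (?c - p)) > 0"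
        using side[OF c] x' zero_less_mult_pos2[of "((u \<bullet> velocity) * \<sigma>) * (u \<bullet> (?c - p))" x]
        by (simp add: mult.assoc mult.left_commute)
      then have "u \<bullet> (?c - p) < 0"
        using \<sigma>u zero_less_mult_iff[of "(u \<bullet> velocity) * \<sigma>" "u \<bullet> (?c - p)"] by linarith
      ultimately show "?c \<in> \<Gamma> \<and> dist p ?c = \<epsilon> \<and> height u ?c < height u p"
        using in_\<Gamma>[OF c] by (simp add: height_def inner_diff_right)
    next
      fix q assume q: "q \<in> \<Gamma>" "height u q < height u p" and d: "\<epsilon> = dist p q"
      then obtain s where s: "s \<noteq> t" "\<bar>s - t\<bar> < \<delta>" "q = \<gamma> s"
        using near[of q] \<epsilon> by (auto simp: \<rho>_def dist_commute)
      have "u \<bullet> (\<gamma> s - p) < 0" using q s by (simp add: height_def inner_diff_right)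
      then have "(u \<bullet> velocity) * (s - t) < 0"
        using side[OF s(1,2)] zero_less_mult_iff[of "u \<bullet> (\<gamma> s - p)" "(u \<bullet> velocity) * (s - t)"]
        by (simp add: mult.assoc mult.left_commute)
      then have "s - t = \<sigma> * \<bar>s - t\<bar>"
        by (auto simp: \<sigma>_def sgn_if mult_less_0_iff abs_if)
      then have s_eq: "s = t + \<sigma> * \<bar>s - t\<bar>" by simp
      have "N \<bar>s - t\<bar> = N x"
        unfolding sq_dist[of "\<bar>s - t\<bar>"] s_eq[symmetric] using x(3) d s by simp
      then have "\<bar>s - t\<bar> = x"
        using mono[of x "\<bar>s - t\<bar>"] mono[of "\<bar>s - t\<bar>" x] x' s(2) abs_ge_zero[of "s - t"] by linarith
      then show "q = ?c" using s s_eq by simp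
    qed
  qed
  with \<open>\<rho> > 0\<close> show ?thesis
    unfolding eventually_at_right_field by iprover
qed

lemma weight_eq_0:
  assumes u: "u \<bullet> velocity \<noteq> 0"
  shows "weight \<Gamma> p u = 0"
proof -
  let ?S = "\<lambda>\<epsilon>. {q \<in> \<Gamma>. dist p q = \<epsilon> \<and> height u q < height u p}"
  have ev: "\<forall>\<^sub>F \<epsilon> in at_right 0. finite (?S \<epsilon>) \<and> card (?S \<epsilon>) = 1"
    using unique_lower_point[OF u]
  proof eventually_elim
    case (elim \<epsilon>)
    then obtain c where "?S \<epsilon> = {c}" by iprover
    then show ?case by (simp only: finite.emptyI finite_insert is_singletonI is_singleton_altdef[symmetric])
  qed
  have "d_minus \<Gamma> p u = 1"
    unfolding d_minus_def
  proof (rule the_equality)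
    show "\<forall>\<^sub>F \<epsilon> in at_right 0. finite (?S \<epsilon>) \<and> card (?S \<epsilon>) = 1" by (rule ev)
    fix n assume "\<forall>\<^sub>F \<epsilon> in at_right 0. finite (?S \<epsilon>) \<and> card (?S \<epsilon>) = n"
    with ev have "\<forall>\<^sub>F \<epsilon> in at_right (0::real). n = 1"
      by eventually_elim simp
    then show "n = 1" by simp
  qed
  moreover have "\<not> local_minimum_on (height u) \<Gamma> p"
  proof
    assume "local_minimum_on (height u) \<Gamma> p"
    then obtain d where d: "d > 0"
      and le: "\<And>q. q \<in> \<Gamma> \<Longrightarrow> q \<noteq> p \<Longrightarrow> dist q p < d \<Longrightarrow> height u p \<le> height u q"
      unfolding local_minimum_on_def eventually_at by blast
    have "\<forall>\<^sub>F \<epsilon> in at_right 0. \<epsilon> < d"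
      using d by (rule order_tendstoD(2)[OF tendsto_ident_at])
    with unique_lower_point[OF u] have "\<forall>\<^sub>F \<epsilon> in at_right (0::real). False"
    proof eventually_elim
      case (elim \<epsilon>)
      then obtain q where "?S \<epsilon> = {q}" by iprover
      then have "q \<in> ?S \<epsilon>" by (simp only: singletonI)
      then have q: "q \<in> \<Gamma>" "dist q p = \<epsilon>" "height u q < height u p"
        by (simp_all add: dist_commute)
      from le[of q] q elim(2) show False by fastforce
    qed
    then show False by simp
  qed
  ultimately show ?thesis by (simp add: weight_def)
qed

end


section \<open>Comparison of two vertex sets\<close>

text \<open>Openness holds because the edges are the components of \<open>\<Gamma> - V\<close>, there are finitely many
  of them, and \<open>V\<close> is closed.\<close>

lemma open_edge:
  assumes graph: "semialgebraic_graph \<Gamma> V" and E: "E \<in> open_edges \<Gamma> V"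
  shows "openin (top_of_set \<Gamma>) E" and "\<exists>\<gamma>. arc_param \<gamma> E"
proof -
  let ?X = "\<Gamma> - V"
  obtain \<E> where dec: "edge_decomposition \<Gamma> V \<E>" and V: "finite V"
    using graph by (auto simp: semialgebraic_graph_def)
  have \<E>: "\<E> = components ?X"
    using edge_decomposition_unique[OF dec] by (simp add: open_edges_def)
  show "\<exists>\<gamma>. arc_param \<gamma> E"
    using dec E edge_decomposition_unique[OF dec]
    unfolding edge_decomposition_def analytic_arc_between_def by metis
  have fin: "finite (components ?X)"
    using dec \<E> by (simp add: edge_decomposition_def)
  have EX: "E \<in> components ?X" using E by (simp add: open_edges_def)
  have "closedin (top_of_set ?X) (\<Union>(components ?X - {E}))"
    using fin by (intro closedin_Union) (auto simp: closedin_component)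
  moreover have "E = ?X - \<Union>(components ?X - {E})"
    using EX Union_components[of ?X] components_nonoverlap[of E ?X] by blast
  ultimately have "openin (top_of_set ?X) E"
    by (metis openin_diff openin_subtopology_self)
  moreover have "openin (top_of_set \<Gamma>) ?X"
    using V by (simp add: Diff_eq finite_imp_closed open_Compl openin_open_Int)
  ultimately show "openin (top_of_set \<Gamma>) E" by (rule openin_trans)
qed

lemma point_on_open_edge:
  assumes graph: "semialgebraic_graph \<Gamma> V" and p: "p \<in> \<Gamma> - V"
  obtains E \<gamma> t where "E \<in> open_edges \<Gamma> V" "p \<in> E" "open_arc \<Gamma> E \<gamma> t" "p = \<gamma> t"
proof -
  obtain E where E: "E \<in> open_edges \<Gamma> V" "p \<in> E"
    using p Union_components unfolding open_edges_def by blast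
  obtain \<gamma> where \<gamma>: "arc_param \<gamma> E" using open_edge(2)[OF graph E(1)] by blast
  then obtain t where "t \<in> {0<..<1}" "p = \<gamma> t" using E by (auto simp: arc_param_def)
  with E \<gamma> open_edge(1)[OF graph E(1)] show thesis
    by (intro that[of E \<gamma> t]) (auto simp: open_arc_def)
qed

lemma critical_point_iff_slope:
  assumes graph: "semialgebraic_graph \<Gamma> V" and E: "E \<in> open_edges \<Gamma> V" and p: "p \<in> E"
  shows "critical_point (height u) E p \<longleftrightarrow>
           ((\<lambda>q. \<bar>u \<bullet> (q - p)\<bar> / norm (q - p)) \<longlongrightarrow> 0) (at p within \<Gamma>)" (is "_ \<longleftrightarrow> ?slope")
proof -
  have key: "deriv (height u \<circ> \<gamma>) t = 0 \<longleftrightarrow> ?slope"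
    if "arc_param \<gamma> E" "t \<in> {0<..<1}" "\<gamma> t = p" for \<gamma> t
  proof -
    interpret open_arc \<Gamma> E \<gamma> t
      using that open_edge[OF graph E] by unfold_locales
    show ?thesis using slope_tendsto_0_iff[of u] deriv_height[of u] that by simp
  qed
  obtain \<gamma> where \<gamma>: "arc_param \<gamma> E" using open_edge(2)[OF graph E] by blast
  then obtain t where t: "t \<in> {0<..<1}" "\<gamma> t = p" using p by (auto simp: arc_param_def)
  show ?thesis
  proof
    assume "critical_point (height u) E p"
    then show ?slope unfolding critical_point_def using key by blast
  next
    assume ?slope
    with key[OF \<gamma> t] \<gamma> t show "critical_point (height u) E p"
      unfolding critical_point_def by blast
  qed
qed

lemma nondegenerate_critical_point_iff_curvature:
  assumes graph: "semialgebraic_graph \<Gamma> V" and E: "E \<in> open_edges \<Gamma> V" and p: "p \<in> E"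
    and crit: "critical_point (height u) E p"
  shows "nondegenerate_critical_point (height u) E p \<longleftrightarrow>
           \<not> ((\<lambda>q. u \<bullet> (q - p) / (norm (q - p))\<^sup>2) \<longlongrightarrow> 0) (at p within \<Gamma>)" (is "_ \<longleftrightarrow> \<not> ?curv")
proof -
  have key: "deriv (deriv (height u \<circ> \<gamma>)) t = 0 \<longleftrightarrow> ?curv"
    if "arc_param \<gamma> E" "t \<in> {0<..<1}" "\<gamma> t = p" "deriv (height u \<circ> \<gamma>) t = 0" for \<gamma> t
  proof -
    interpret open_arc \<Gamma> E \<gamma> t
      using that open_edge[OF graph E] by unfold_locales
    show ?thesis using curvature_tendsto_0_iff[of u] deriv_height[of u] that by simp
  qed
  obtain \<gamma> t where \<gamma>: "arc_param \<gamma> E" "t \<in> {0<..<1}" "\<gamma> t = p" "deriv (height u \<circ> \<gamma>) t = 0"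
    using crit unfolding critical_point_def by blast
  show ?thesis
  proof
    assume "nondegenerate_critical_point (height u) E p"
    then show "\<not> ?curv" unfolding nondegenerate_critical_point_def using key by blast
  next
    assume "\<not> ?curv"
    with key[OF \<gamma>] \<gamma> show "nondegenerate_critical_point (height u) E p"
      unfolding nondegenerate_critical_point_def by blast
  qed
qed

lemma weight_eq_0_if_noncritical:
  assumes graph: "semialgebraic_graph \<Gamma> V" and p: "p \<in> \<Gamma>"
    and "p \<notin> stratified_critical_points \<Gamma> V u"
  shows "weight \<Gamma> p u = 0"
proof -
  have pV: "p \<in> \<Gamma> - V" using assms by (auto simp: stratified_critical_points_def)
  obtain E \<gamma> t where E: "E \<in> open_edges \<Gamma> V" "p \<in> E" and arc: "open_arc \<Gamma> E \<gamma> t" "p = \<gamma> t"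
    by (rule point_on_open_edge[OF graph pV])
  then interpret open_arc \<Gamma> E \<gamma> t by simp
  have "\<not> critical_point (height u) E p"
    using assms(3) E by (auto simp: stratified_critical_points_def)
  then have "u \<bullet> velocity \<noteq> 0"
    using critical_point_iff_slope[OF graph E] slope_tendsto_0_iff[of u] arc(2) by simp
  then show ?thesis using weight_eq_0 arc(2) by simp
qed

lemma stratified_critical_points_diff:
  assumes graph: "semialgebraic_graph \<Gamma> V" and graph': "semialgebraic_graph \<Gamma> V'"
  shows "stratified_critical_points \<Gamma> V u - stratified_critical_points \<Gamma> V' u \<subseteq> V"
proof
  fix p assume p: "p \<in> stratified_critical_points \<Gamma> V u - stratified_critical_points \<Gamma> V' u"
  show "p \<in> V"
  proof (rule ccontr)
    assume "p \<notin> V"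
    then obtain E where E: "E \<in> open_edges \<Gamma> V" "p \<in> E" and crit: "critical_point (height u) E p"
      using p by (auto simp: stratified_critical_points_def)
    have "p \<in> \<Gamma> - V'"
      using p E in_components_subset unfolding open_edges_def stratified_critical_points_def by blast
    then obtain E' where E': "E' \<in> open_edges \<Gamma> V'" "p \<in> E'"
      using point_on_open_edge[OF graph'] by blast
    then have "critical_point (height u) E' p"
      using crit critical_point_iff_slope[OF graph E] critical_point_iff_slope[OF graph' E'] by simp
    then show False using p E' by (auto simp: stratified_critical_points_def)
  qed
qed

lemma stratified_critical_points_subset:
  assumes "semialgebraic_graph \<Gamma> V"
  shows "stratified_critical_points \<Gamma> V u \<subseteq> \<Gamma>"
  using assms in_components_subset
  unfolding stratified_critical_points_def semialgebraic_graph_def open_edges_def by blast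

text \<open>The critical sets differ by finitely many points of weight \<open>0\<close>. This also settles directions
  with infinitely many critical points, since then both sums have the value \<open>0\<close> by convention.\<close>

lemma total_weight_vertex_independent:
  assumes graph: "semialgebraic_graph \<Gamma> V" and graph': "semialgebraic_graph \<Gamma> V'"
  shows "total_weight \<Gamma> V u = total_weight \<Gamma> V' u"
proof -
  let ?C = "stratified_critical_points \<Gamma> V u" and ?C' = "stratified_critical_points \<Gamma> V' u"
  have fin: "finite (?C - ?C')"
    by (rule finite_subset[OF stratified_critical_points_diff[OF graph graph']])
       (use graph in \<open>simp add: semialgebraic_graph_def\<close>)
  have fin': "finite (?C' - ?C)"
    by (rule finite_subset[OF stratified_critical_points_diff[OF graph' graph]])
       (use graph' in \<open>simp add: semialgebraic_graph_def\<close>)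
  have zero: "weight \<Gamma> p u = 0" if "p \<in> (?C - ?C') \<union> (?C' - ?C)" for p
    using that weight_eq_0_if_noncritical[OF graph, of p u] weight_eq_0_if_noncritical[OF graph', of p u]
      stratified_critical_points_subset[OF graph, of u] stratified_critical_points_subset[OF graph', of u]
    by blast
  show ?thesis
  proof (cases "finite ?C")
    case True
    have "finite ?C'"
      using fin' True by (simp add: finite_Diff2)
    with True show ?thesis
      unfolding total_weight_def using zero by (intro sum.mono_neutral_cong) auto
  next
    case False
    have "infinite ?C'"
      using fin False finite_Diff2[of ?C' ?C] by blast
    with False show ?thesis by (simp add: total_weight_def)
  qed
qed

text \<open>The condition on \<open>u\<close> excludes the tangents at the points that are vertices for only one of the
  two sets. At a new vertex \<open>v \<in> V' - V\<close> it gives the condition on limit directions; at a lost vertex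
  \<open>v \<in> V - V'\<close> it makes \<open>v\<close> noncritical. Everywhere else the criteria in terms of \<open>\<Gamma>\<close> transfer the
  condition unchanged.\<close>

lemma nondegenerate_direction_transfer:
  assumes graph: "semialgebraic_graph \<Gamma> V" and graph': "semialgebraic_graph \<Gamma> V'"
    and nd: "nondegenerate_direction \<Gamma> V u"
    and u: "\<And>p E \<gamma> t. p \<in> V - V' \<union> (V' - V) \<Longrightarrow> open_arc \<Gamma> E \<gamma> t \<Longrightarrow> p = \<gamma> t \<Longrightarrow>
              u \<bullet> vector_derivative \<gamma> (at t) \<noteq> 0"
  shows "nondegenerate_direction \<Gamma> V' u"
  unfolding nondegenerate_direction_def
proof (intro conjI ballI impI)
  show "u \<in> sphere 0 1" using nd by (simp add: nondegenerate_direction_def)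
next
  fix E' p assume E': "E' \<in> open_edges \<Gamma> V'" "p \<in> E'" and crit: "critical_point (height u) E' p"
  have p: "p \<in> \<Gamma> - V'" using E' in_components_subset unfolding open_edges_def by blast
  have "p \<notin> V"
  proof
    assume "p \<in> V"
    obtain E'' \<gamma> t where E'': "E'' \<in> open_edges \<Gamma> V'" "p \<in> E''" and arc: "open_arc \<Gamma> E'' \<gamma> t" "p = \<gamma> t"
      by (rule point_on_open_edge[OF graph' p])
    interpret open_arc \<Gamma> E'' \<gamma> t by fact
    have "u \<bullet> velocity = 0"
      using crit critical_point_iff_slope[OF graph' E'] slope_tendsto_0_iff[of u] arc(2) by simp
    then show False using u[OF _ arc] \<open>p \<in> V\<close> p by blast
  qed
  then obtain E where E: "E \<in> open_edges \<Gamma> V" "p \<in> E"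
    using p point_on_open_edge[OF graph] by blast
  have critE: "critical_point (height u) E p"
    using crit critical_point_iff_slope[OF graph E] critical_point_iff_slope[OF graph' E'] by simp
  then have "nondegenerate_critical_point (height u) E p"
    using nd E by (simp add: nondegenerate_direction_def)
  then show "nondegenerate_critical_point (height u) E' p"
    using nondegenerate_critical_point_iff_curvature[OF graph E critE]
      nondegenerate_critical_point_iff_curvature[OF graph' E' crit] by simp
next
  fix v \<tau> assume v: "v \<in> V'" and \<tau>: "\<tau> \<in> limit_directions \<Gamma> v"
  show "u \<bullet> \<tau> \<noteq> 0"
  proof (cases "v \<in> V")
    case True
    then show ?thesis using nd \<tau> by (simp add: nondegenerate_direction_def)
  next
    case False
    then have "v \<in> \<Gamma> - V" using v graph' by (auto simp: semialgebraic_graph_def)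
    then obtain E \<gamma> t where arc: "open_arc \<Gamma> E \<gamma> t" "v = \<gamma> t"
      using point_on_open_edge[OF graph] by metis
    interpret open_arc \<Gamma> E \<gamma> t by fact
    have "u \<bullet> velocity \<noteq> 0"
      by (rule u[OF _ arc]) (use v False in blast)
    then show ?thesis
      using inner_limit_direction[of \<tau> u] \<tau> arc(2) velocity_nonzero by auto
  qed
qed


section \<open>Great circles have zero area\<close>

text \<open>The function is a sine wave with shifted phase.\<close>

lemma countable_zeros_sin_cos:
  fixes a b :: real
  assumes "a \<noteq> 0 \<or> b \<noteq> 0"
  shows "countable {\<theta>. a * sin \<theta> + b * cos \<theta> = 0}"
proof -
  obtain r \<alpha> where r: "a = r * cos \<alpha>" "b = r * sin \<alpha>"
    using polar_Ex by blast
  have "a * sin \<theta> + b * cos \<theta> = r * sin (\<theta> + \<alpha>)" for \<theta>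
    by (simp add: r sin_add algebra_simps)
  moreover have "r \<noteq> 0" using assms r by auto
  ultimately have "{\<theta>. a * sin \<theta> + b * cos \<theta> = 0} \<subseteq> range (\<lambda>i::int. of_int i * pi - \<alpha>)"
    by (force simp: sin_zero_iff_int2 algebra_simps)
  then show ?thesis by (rule countable_subset) simp
qed

text \<open>In spherical coordinates, for almost every longitude \<open>\<phi>\<close> the equation \<open>u \<bullet> T = 0\<close> is a
  nontrivial relation between \<open>sin \<theta>\<close> and \<open>cos \<theta>\<close>, so it has countably many solutions; Fubini does
  the rest. The exceptional longitudes are those in which the whole meridian lies on the great circle,
  and they occur only when \<open>T\<close> is horizontal.\<close>

lemma great_circle_null:
  assumes "T \<noteq> 0"
  shows "AE u in sphere_area. u \<bullet> T \<noteq> 0"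
proof -
  let ?w = "\<lambda>(\<theta>, \<phi>). ennreal (indicator ({0..pi} \<times> {0..2*pi}) (\<theta>, \<phi>) * sin \<theta>)"
  have w [measurable]: "?w \<in> borel_measurable (borel \<Otimes>\<^sub>M borel)" by measurable
  define a b c where "a = T $ 1" and "b = T $ 2" and "c = T $ 3"
  have abc: "a \<noteq> 0 \<or> b \<noteq> 0 \<or> c \<noteq> 0"
    using assms by (auto simp: a_def b_def c_def vec_eq_iff forall_3)
  have inner: "spherical (\<theta>, \<phi>) \<bullet> T = (b * sin \<phi> + a * cos \<phi>) * sin \<theta> + c * cos \<theta>" for \<theta> \<phi>
    by (simp add: spherical_def inner_vec_def sum_3 vector_3 a_def b_def c_def algebra_simps)
  have null: "AE x in lborel. x \<notin> A" if "countable A" for A :: "real set"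
    using that by (intro AE_not_in countable_imp_null_set_lborel)
  have "AE \<phi> in lborel. AE \<theta> in lborel. spherical (\<theta>, \<phi>) \<bullet> T \<noteq> 0"
  proof (cases "c = 0")
    case True
    with abc have "countable {\<phi>. b * sin \<phi> + a * cos \<phi> = 0}"
      by (intro countable_zeros_sin_cos) auto
    then have "AE \<phi> in lborel. b * sin \<phi> + a * cos \<phi> \<noteq> 0"
      using null by fastforce
    then show ?thesis
    proof eventually_elim
      case (elim \<phi>)
      then show ?case
        using null[OF countable_zeros_sin_cos[of "b * sin \<phi> + a * cos \<phi>" c]] by (simp add: inner)
    qed
  next
    case False
    then show ?thesis
      using null[OF countable_zeros_sin_cos[of _ c]] by (simp add: inner)
  qed
  then have "AE \<theta> in lborel. AE \<phi> in lborel. spherical (\<theta>, \<phi>) \<bullet> T \<noteq> 0"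
    by (subst lborel_pair.AE_commute) measurable
  moreover have [measurable]: "spherical \<in> borel_measurable (borel \<Otimes>\<^sub>M borel)"
    using spherical_measurable by (simp add: borel_prod)
  have "{x \<in> space (lborel \<Otimes>\<^sub>M lborel). spherical x \<bullet> T \<noteq> 0} \<in> sets (lborel \<Otimes>\<^sub>M lborel)"
    by measurable
  ultimately have "AE x in lborel \<Otimes>\<^sub>M lborel. spherical x \<bullet> T \<noteq> 0"
    by (intro lborel_pair.AE_pair_measure) auto
  then have "AE x in lborel. spherical x \<bullet> T \<noteq> 0"
    by (simp only: lborel_prod)
  then have "AE x in density lborel ?w. spherical x \<bullet> T \<noteq> 0"
    by (subst AE_density) (auto simp: borel_prod[symmetric])
  then have "AE u in distr (density lborel ?w) borel spherical. u \<bullet> T \<noteq> 0"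
    by (subst AE_distr_iff) auto
  then show ?thesis
    unfolding sphere_area_def by (rule AE_completion)
qed

text \<open>In a complete measure space measurability passes from one function to the
  other, and if neither is measurable both integrals are \<open>0\<close>. This avoids showing that the
  nondegenerate directions form a measurable set.\<close>

lemma (in complete_measure) integral_cong_AE_complete:
  fixes f g :: "'a \<Rightarrow> real"
  assumes ae: "AE x in M. f x = g x"
  shows "integral\<^sup>L M f = integral\<^sup>L M g"
proof -
  have meas: "g \<in> borel_measurable M"
    if "f \<in> borel_measurable M" and ae: "AE x in M. f x = g x" for f g :: "'a \<Rightarrow> real"
  proof (rule measurableI)
    fix A :: "real set" assume "A \<in> sets borel"
    then have "f -` A \<inter> space M \<in> sets M"
      using that by measurable
    moreover have "AE x in M. x \<in> f -` A \<inter> space M \<longleftrightarrow> x \<in> g -` A \<inter> space M"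
      using ae by eventually_elim auto
    ultimately show "g -` A \<inter> space M \<in> sets M"
      using in_sets_AE by blast
  qed simp
  show ?thesis
  proof (cases "f \<in> borel_measurable M")
    case True
    then show ?thesis using meas[OF True ae] ae by (intro integral_cong_AE)
  next
    case False
    moreover have "AE x in M. g x = f x" using ae by eventually_elim simp
    ultimately have "g \<notin> borel_measurable M" using meas by blast
    with False show ?thesis
      by (metis borel_measurable_integrable not_integrable_integral_eq)
  qed
qed


section \<open>Independence of the vertex set\<close>

theorem corollary2p6:
  fixes \<Gamma> V V' :: "(real^3) set"
  assumes "semialgebraic_curve \<Gamma>"
    and "semialgebraic_graph \<Gamma> V"
    and "semialgebraic_graph \<Gamma> V'"
  shows "total_curvature \<Gamma> V = total_curvature \<Gamma> V'"
proof -
  note graph = assms(2) and graph' = assms(3)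
  let ?S = "V - V' \<union> (V' - V)"
  \<comment> \<open>one tangent vector per point suffices: by the slope criterion every arc through \<open>p\<close> has
    the same orthogonal directions\<close>
  have "\<exists>T. T \<noteq> 0 \<and> (\<forall>u E \<gamma> t. open_arc \<Gamma> E \<gamma> t \<longrightarrow> p = \<gamma> t \<longrightarrow> u \<bullet> T \<noteq> 0 \<longrightarrow>
               u \<bullet> vector_derivative \<gamma> (at t) \<noteq> 0)" if p: "p \<in> ?S" for p
  proof -
    have "p \<in> \<Gamma> - V \<or> p \<in> \<Gamma> - V'"
      using p graph graph' by (auto simp: semialgebraic_graph_def)
    then obtain E0 \<gamma>0 t0 where arc0: "open_arc \<Gamma> E0 \<gamma>0 t0" and p0: "p = \<gamma>0 t0"
      using point_on_open_edge[OF graph] point_on_open_edge[OF graph'] by metis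
    show ?thesis
    proof (intro exI conjI allI impI)
      show "vector_derivative \<gamma>0 (at t0) \<noteq> 0"
        by (rule open_arc.velocity_nonzero[OF arc0])
      fix u E \<gamma> t
      assume arc: "open_arc \<Gamma> E \<gamma> t" "p = \<gamma> t" and u: "u \<bullet> vector_derivative \<gamma>0 (at t0) \<noteq> 0"
      show "u \<bullet> vector_derivative \<gamma> (at t) \<noteq> 0"
        using open_arc.slope_tendsto_0_iff[OF arc0, of u] open_arc.slope_tendsto_0_iff[OF arc(1), of u]
          u p0 arc(2) by simp
    qed
  qed
  then obtain T where T: "\<And>p. p \<in> ?S \<Longrightarrow> T p \<noteq> 0"
    and trans: "\<And>p u E \<gamma> t. p \<in> ?S \<Longrightarrow> open_arc \<Gamma> E \<gamma> t \<Longrightarrow> p = \<gamma> t \<Longrightarrow> u \<bullet> T p \<noteq> 0 \<Longrightarrow>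
              u \<bullet> vector_derivative \<gamma> (at t) \<noteq> 0"
    by metis
  have "finite ?S" using graph graph' by (auto simp: semialgebraic_graph_def)
  then have "AE u in sphere_area. \<forall>p\<in>?S. u \<bullet> T p \<noteq> 0"
    using T by (intro AE_finite_allI great_circle_null)
  then have "AE u in sphere_area. nondegenerate_direction \<Gamma> V u \<longleftrightarrow> nondegenerate_direction \<Gamma> V' u"
  proof eventually_elim
    case (elim u)
    have *: "u \<bullet> vector_derivative \<gamma> (at t) \<noteq> 0"
      if "p \<in> ?S" "open_arc \<Gamma> E \<gamma> t" "p = \<gamma> t" for p E \<gamma> t
      using trans[OF that] elim that(1) by blast
    show ?case
      using nondegenerate_direction_transfer[OF graph graph', of u]
        nondegenerate_direction_transfer[OF graph' graph, of u] *
      by (metis Un_commute)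
  qed
  then have "AE u in sphere_area.
      indicator {u. nondegenerate_direction \<Gamma> V u} u *\<^sub>R real_of_int (total_weight \<Gamma> V u) =
      indicator {u. nondegenerate_direction \<Gamma> V' u} u *\<^sub>R real_of_int (total_weight \<Gamma> V' u)"
    by eventually_elim
      (simp add: indicator_def total_weight_vertex_independent[OF graph graph'])
  then show ?thesis
    unfolding total_curvature_def set_lebesgue_integral_def sphere_area_def
    by (simp add: completion.integral_cong_AE_complete)
qed

end
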